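(* For any Leibniz algebra $\mathfrak{g}$, the $\mathsf{Lie}$-centroid $\Gamma^{\mathsf{Lie}}(\mathfrak{g})$ is a subalgebra of $\mathrm{End}(\mathfrak{g})$ such that $\mathsf{Der}_z^{\mathsf{Lie}}(\mathfrak{g})=\mathsf{Der}^{\mathsf{Lie}}(\mathfrak{g})\cap\Gamma^{\mathsf{Lie}}(\mathfrak{g})$.
   Context: $\mathbb{K}$ is a fixed ground field with $\frac12\in\mathbb{K}$. A Leibniz algebra over $\mathbb{K}$ is a $\mathbb{K}$-vector space $\mathfrak{g}$ with a bilinear bracket satisfying $[x,[y,z]]=[[x,y],z]-[[x,z],y]$ for all $x,y,z$. Put $[x,y]_{lie}=[x,y]+[y,x]$. The $\mathsf{Lie}$-center is $Z_{\mathsf{Lie}}(\mathfrak{g})=\{z\in\mathfrak{g}\mid [g,z]_{lie}=0\ \text{for all } g\in\mathfrak{g}\}$. A $\mathsf{Lie}$-derivation of $\mathfrak{g}$ is a linear map $d:\mathfrak{g}\to\mathfrak{g}$ with $d([x,y]_{lie})=[d(x),y]_{lie}+[x,d(y)]_{lie}$ for all $x,y$; $\mathsf{Der}^{\mathsf{Lie}}(\mathfrak{g})$ is the set of these and $\mathsf{Der}_z^{\mathsf{Lie}}(\mathfrak{g})$ the subset of those $d$ with $d(\mathfrak{g})\subseteq Z_{\mathsf{Lie}}(\mathfrak{g})$. The $\mathsf{Lie}$-centroid $\Gamma^{\mathsf{Lie}}(\mathfrak{g})$ is the set of all linear maps $d:\mathfrak{g}\to\mathfrak{g}$ with $d([x,y]_{lie})=[d(x),y]_{lie}=[x,d(y)]_{lie}$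 for all $x,y\in\mathfrak{g}$. $\mathrm{End}(\mathfrak{g})$ is the algebra of linear endomorphisms of $\mathfrak{g}$ under composition. *)

theory Defs
  imports Complex_Main "HOL-Library.Function_Algebras"
begin

text \<open>The ground field is a type \<open>'k\<close> of class \<open>field\<close> and the vector space is a
  type \<open>'g\<close> with an explicit scalar multiplication \<open>scale\<close>.  The Leibniz identity is the
  right-handed one: right multiplications are derivations.\<close>

locale leibniz_algebra = vector_space scale
  for scale :: "'k::field \<Rightarrow> 'g::ab_group_add \<Rightarrow> 'g" +
  fixes bracket :: "'g \<Rightarrow> 'g \<Rightarrow> 'g"
  assumes linear_bracket_left: "\<And>y. Vector_Spaces.linear scale scale (\<lambda>x. bracket x y)"
    and linear_bracket_right: "\<And>x. Vector_Spaces.linear scale scale (\<lambda>y. bracket x y)"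
    and leibniz_identity:
      "\<And>x y z. bracket x (bracket y z) = bracket (bracket x y) z - bracket (bracket x z) y"

definition lie_bracket :: "('g::ab_group_add \<Rightarrow> 'g \<Rightarrow> 'g) \<Rightarrow> 'g \<Rightarrow> 'g \<Rightarrow> 'g" where
  "lie_bracket bracket x y = bracket x y + bracket y x"

definition lie_center :: "('g::ab_group_add \<Rightarrow> 'g \<Rightarrow> 'g) \<Rightarrow> 'g set" where
  "lie_center bracket = {z. \<forall>g. lie_bracket bracket g z = 0}"

definition linear_endos :: "('k::field \<Rightarrow> 'g::ab_group_add \<Rightarrow> 'g) \<Rightarrow> ('g \<Rightarrow> 'g) set" where
  "linear_endos scale = {d. Vector_Spaces.linear scale scale d}"

definition lie_derivations ::
    "('k::field \<Rightarrow> 'g::ab_group_add \<Rightarrow> 'g) \<Rightarrow> ('g \<Rightarrow> 'g \<Rightarrow> 'g) \<Rightarrow> ('g \<Rightarrow> 'g) set" where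
  "lie_derivations scale bracket =
    {d \<in> linear_endos scale. \<forall>x y.
       d (lie_bracket bracket x y) = lie_bracket bracket (d x) y + lie_bracket bracket x (d y)}"

definition central_lie_derivations ::
    "('k::field \<Rightarrow> 'g::ab_group_add \<Rightarrow> 'g) \<Rightarrow> ('g \<Rightarrow> 'g \<Rightarrow> 'g) \<Rightarrow> ('g \<Rightarrow> 'g) set" where
  "central_lie_derivations scale bracket =
    {d \<in> lie_derivations scale bracket. range d \<subseteq> lie_center bracket}"

definition lie_centroid ::
    "('k::field \<Rightarrow> 'g::ab_group_add \<Rightarrow> 'g) \<Rightarrow> ('g \<Rightarrow> 'g \<Rightarrow> 'g) \<Rightarrow> ('g \<Rightarrow> 'g) set" where
  "lie_centroid scale bracket =
    {d \<in> linear_endos scale. \<forall>x y.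
       d (lie_bracket bracket x y) = lie_bracket bracket (d x) y \<and>
       lie_bracket bracket (d x) y = lie_bracket bracket x (d y)}"

text \<open>Addition and zero of functions are the pointwise ones of \<open>Function_Algebras\<close>; the
  product of the endomorphism algebra is composition (not the pointwise product of that theory)
  and its unit is \<open>id\<close>.  Subalgebras are understood to be unital.\<close>

definition endo_scale ::
    "('k::field \<Rightarrow> 'g::ab_group_add \<Rightarrow> 'g) \<Rightarrow> 'k \<Rightarrow> ('g \<Rightarrow> 'g) \<Rightarrow> 'g \<Rightarrow> 'g" where
  "endo_scale scale c f = (\<lambda>x. scale c (f x))"

definition subalgebra_of_endos ::
    "('k::field \<Rightarrow> 'g::ab_group_add \<Rightarrow> 'g) \<Rightarrow> ('g \<Rightarrow> 'g) set \<Rightarrow> bool" where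
  "subalgebra_of_endos scale A \<longleftrightarrow>
     A \<subseteq> linear_endos scale \<and>
     module.subspace (endo_scale scale) A \<and>
     id \<in> A \<and>
     (\<forall>f\<in>A. \<forall>g\<in>A. f \<circ> g \<in> A)"

lemma vector_space_endo_scale:
  assumes "vector_space scale"
  shows "vector_space (endo_scale scale)"
proof -
  interpret vector_space scale by fact
  show ?thesis
    by unfold_locales (simp_all add: endo_scale_def fun_eq_iff scale_right_distrib scale_left_distrib)
qed

end

theory Submission imports Defs begin

text \<open>The bracket [x,y]_lie is symmetric and bilinear. By symmetry, the two centroid
  conditions collapse to the single identity d[x,y]_lie = [dx,y]_lie
  (\<open>lie_centroid_iff\<close>). It says that d commutes with every operator [-,y]_lie, so the
  centroid is a commutant and hence a unital subalgebra. For a derivation, the same identity differs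
  from the Leibniz rule by exactly the term [x,dy]_lie, so it holds for all x, y iff d takes values
  in the Lie-center.\<close>

context leibniz_algebra
begin

lemma lie_bracket_commute: "lie_bracket bracket x y = lie_bracket bracket y x"
  by (simp add: lie_bracket_def add.commute)

lemma lie_bracket_add_left:
  "lie_bracket bracket (x + x') y = lie_bracket bracket x y + lie_bracket bracket x' y"
  using Vector_Spaces.linear.axioms(3)[OF linear_bracket_left, THEN module_hom.add]
    Vector_Spaces.linear.axioms(3)[OF linear_bracket_right, THEN module_hom.add]
  by (simp add: lie_bracket_def algebra_simps)

lemma lie_bracket_scale_left:
  "lie_bracket bracket (scale c x) y = scale c (lie_bracket bracket x y)"
  using Vector_Spaces.linear.axioms(3)[OF linear_bracket_left, THEN module_hom.scale]
    Vector_Spaces.linear.axioms(3)[OF linear_bracket_right, THEN module_hom.scale]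
  by (simp add: lie_bracket_def scale_right_distrib)

lemma lie_bracket_zero_left: "lie_bracket bracket 0 y = 0"
  using lie_bracket_add_left[of 0 0 y] by simp

text \<open>Symmetry moves d to the other slot: [dx,y] = d[x,y] = d[y,x] = [dy,x] = [x,dy], all
  brackets being Lie-symmetrized.\<close>

lemma lie_centroid_iff:
  "d \<in> lie_centroid scale bracket \<longleftrightarrow>
    Vector_Spaces.linear scale scale d \<and>
    (\<forall>x y. d (lie_bracket bracket x y) = lie_bracket bracket (d x) y)"
proof -
  have "lie_bracket bracket (d x) y = lie_bracket bracket x (d y)"
    if "\<forall>x y. d (lie_bracket bracket x y) = lie_bracket bracket (d x) y" for x y
    using that by (metis lie_bracket_commute)
  then show ?thesis
    by (auto simp: lie_centroid_def linear_endos_def)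
qed

lemma subalgebra_lie_centroid: "subalgebra_of_endos scale (lie_centroid scale bracket)"
proof -
  interpret endo: vector_space "endo_scale scale"
    by (rule vector_space_endo_scale) unfold_locales
  interpret vector_space_pair scale scale ..
  \<comment> \<open>For fixed x and y the one-sided condition is linear in d, because the
    symmetrized bracket is linear in its left slot.\<close>
  have "endo.subspace (lie_centroid scale bracket)"
    unfolding endo.subspace_def lie_centroid_iff endo_scale_def plus_fun_def zero_fun_def
    by (auto simp: lie_centroid_iff lie_bracket_add_left lie_bracket_scale_left
        lie_bracket_zero_left linear_zero intro: linear_compose_add linear_compose_scale_right)
  moreover have "id \<in> lie_centroid scale bracket"
    by (simp add: lie_centroid_iff linear_id)
  \<comment> \<open>Pull out one map at a time: f(g[x,y]) = f[gx,y] = [f(gx),y].\<close>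
  moreover have "f \<circ> g \<in> lie_centroid scale bracket"
    if "f \<in> lie_centroid scale bracket" "g \<in> lie_centroid scale bracket" for f g
    using that by (auto simp: lie_centroid_iff intro: Vector_Spaces.linear_compose)
  ultimately show ?thesis
    by (auto simp: subalgebra_of_endos_def lie_centroid_def)
qed

lemma central_lie_derivations_eq:
  "central_lie_derivations scale bracket =
    lie_derivations scale bracket \<inter> lie_centroid scale bracket"
proof (intro set_eqI iffI)
  fix d
  assume d: "d \<in> central_lie_derivations scale bracket"
  then have "lie_bracket bracket x (d y) = 0" for x y
    by (auto simp: central_lie_derivations_def lie_center_def)
  \<comment> \<open>With [x,dy] = 0 the Leibniz rule loses its second term and becomes the one-sided
    centroid identity.\<close>
  with d show "d \<in> lie_derivations scale bracket \<inter> lie_centroid scale bracket"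
    by (auto simp: central_lie_derivations_def lie_derivations_def linear_endos_def
        lie_centroid_iff)
next
  fix d
  assume "d \<in> lie_derivations scale bracket \<inter> lie_centroid scale bracket"
  \<comment> \<open>Equating the two expressions for d[x,y] cancels [dx,y] and leaves [x,dy] = 0 for
    every x, so dy is Lie-central.\<close>
  then show "d \<in> central_lie_derivations scale bracket"
    by (auto simp: central_lie_derivations_def lie_derivations_def lie_centroid_iff lie_center_def)
qed

end

theorem proposition4p2:
  fixes scale :: "'k::field \<Rightarrow> 'g::ab_group_add \<Rightarrow> 'g"
    and bracket :: "'g \<Rightarrow> 'g \<Rightarrow> 'g"
  assumes "(2::'k) \<noteq> 0"
    and "leibniz_algebra scale bracket"
  shows "subalgebra_of_endos scale (lie_centroid scale bracket) \<and>
    central_lie_derivations scale bracket =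
      lie_derivations scale bracket \<inter> lie_centroid scale bracket"
  using leibniz_algebra.subalgebra_lie_centroid[OF assms(2)]
    leibniz_algebra.central_lie_derivations_eq[OF assms(2)] ..

end
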